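(* Let $m,n\ge 3$ and let $B_{m,n}$ be the bow graph obtained as the union of two shell graphs $S_m$ and $S_n$ sharing the same apex $c$ (and no other vertex). Then the visibility polynomial of $B_{m,n}$ is $$\mathcal{V}(B_{m,n})=(1+x)^{m+n-2}+x+(m+n-2)x^2+(2m+2n-10)x^3 .$$
   Context: Graphs are finite, simple, undirected and connected. For $X\subseteq V(G)$, two vertices $u,v\in V(G)$ are $X$-visible if there is a shortest $(u,v)$-path $P$ in $G$ with $V(P)\cap X\subseteq\{u,v\}$. A set $X\subseteq V(G)$ is a mutual-visibility set of $G$ if every pair of vertices of $X$ is $X$-visible (in particular the empty set and singletons are mutual-visibility sets). The visibility polynomial of $G$ is $\mathcal{V}(G)=\sum_{i\ge 0} r_i x^i$, where $r_i$ is the number of mutual-visibility sets of $G$ of cardinality $i$ (so $r_0=1$). The shell graph $S_n$ ($n\ge 3$) is $P_{n-1}\vee K_1$, the join of a path $P_{n-1}$ on $n-1$ vertices with a single vertex $c$, called the apex. The bow graph is $B_{m,n}=K_1\vee(P_{m-1}\cup P_{n-1})$, where $K_1=\{c\}$ and $P_{m-1}$, $P_{n-1}$ are disjoint paths on $m-1$ and $n-1$ vertices respectively, with no edges between them. *)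

theory Defs
  imports
    "Graph_Theory.Graph_Theory"
    "HOL-Computational_Algebra.Polynomial"
begin

text \<open>
  Simple graphs are represented as in \<^theory>\<open>Graph_Theory.Pair_Digraph\<close>: a finite undirected
  graph without loops and multiple edges is a \<^locale>\<open>pair_graph\<close>, in which each edge occurs
  as a pair of opposite arcs.
\<close>

definition shortest_vpath :: "'a pair_pre_digraph \<Rightarrow> 'a \<Rightarrow> 'a \<Rightarrow> 'a vwalk \<Rightarrow> bool" where
  "shortest_vpath G u v p \<longleftrightarrow>
     vpath p (with_proj G) \<and> hd p = u \<and> last p = v \<and>
     (\<forall>q. vpath q (with_proj G) \<and> hd q = u \<and> last q = v \<longrightarrow> vwalk_length p \<le> vwalk_length q)"

definition visible :: "'a pair_pre_digraph \<Rightarrow> 'a set \<Rightarrow> 'a \<Rightarrow> 'a \<Rightarrow> bool" where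
  "visible G X u v \<longleftrightarrow> (\<exists>p. shortest_vpath G u v p \<and> set p \<inter> X \<subseteq> {u, v})"

definition mutual_visibility_set :: "'a pair_pre_digraph \<Rightarrow> 'a set \<Rightarrow> bool" where
  "mutual_visibility_set G X \<longleftrightarrow> X \<subseteq> pverts G \<and> (\<forall>u\<in>X. \<forall>v\<in>X. visible G X u v)"

text \<open>
  The coefficients are integers, so that subtraction in closed forms is not truncated. No
  mutual-visibility set of a finite graph has more than \<open>card (pverts G)\<close> elements.
\<close>

definition visibility_poly :: "'a pair_pre_digraph \<Rightarrow> int poly" where
  "visibility_poly G =
     (\<Sum>i\<le>card (pverts G). monom (int (card {X. mutual_visibility_set G X \<and> card X = i})) i)"

definition path_graph :: "nat \<Rightarrow> nat pair_pre_digraph" where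
  "path_graph k =
     \<lparr> pverts = {..<k}, parcs = {(i, j). i < k \<and> j < k \<and> (j = Suc i \<or> i = Suc j)} \<rparr>"

definition single_vertex_graph :: "unit pair_pre_digraph" where
  "single_vertex_graph = \<lparr> pverts = {()}, parcs = {} \<rparr>"

definition disjoint_union_graph ::
  "'a pair_pre_digraph \<Rightarrow> 'b pair_pre_digraph \<Rightarrow> ('a + 'b) pair_pre_digraph" where
  "disjoint_union_graph G H =
     \<lparr> pverts = pverts G <+> pverts H,
       parcs = map_prod Inl Inl ` parcs G \<union> map_prod Inr Inr ` parcs H \<rparr>"

definition join_graph ::
  "'a pair_pre_digraph \<Rightarrow> 'b pair_pre_digraph \<Rightarrow> ('a + 'b) pair_pre_digraph" where
  "join_graph G H =
     \<lparr> pverts = pverts G <+> pverts H,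
       parcs = parcs (disjoint_union_graph G H) \<union>
               (Inl ` pverts G) \<times> (Inr ` pverts H) \<union> (Inr ` pverts H) \<times> (Inl ` pverts G) \<rparr>"

definition shell_graph :: "nat \<Rightarrow> (nat + unit) pair_pre_digraph" where
  "shell_graph n = join_graph (path_graph (n - 1)) single_vertex_graph"

definition bow_graph :: "nat \<Rightarrow> nat \<Rightarrow> (unit + (nat + nat)) pair_pre_digraph" where
  "bow_graph m n =
     join_graph single_vertex_graph
       (disjoint_union_graph (path_graph (m - 1)) (path_graph (n - 1)))"

text \<open>
  The bow graph is the union of copies of two shell graphs that share exactly the apex
  \<open>Inl ()\<close>; it is a simple, connected graph.
\<close>

definition map_graph :: "('a \<Rightarrow> 'b) \<Rightarrow> 'a pair_pre_digraph \<Rightarrow> 'b pair_pre_digraph" where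
  "map_graph f G = \<lparr> pverts = f ` pverts G, parcs = map_prod f f ` parcs G \<rparr>"

definition left_copy :: "nat + unit \<Rightarrow> unit + (nat + nat)" where
  "left_copy = case_sum (\<lambda>i. Inr (Inl i)) Inl"

definition right_copy :: "nat + unit \<Rightarrow> unit + (nat + nat)" where
  "right_copy = case_sum (\<lambda>i. Inr (Inr i)) Inl"

lemma inj_left_copy: "inj left_copy" and inj_right_copy: "inj right_copy"
  by (auto simp: inj_def left_copy_def right_copy_def split: sum.splits)

lemma bow_graph_shell_graphs:
  fixes m n :: nat
  defines "S \<equiv> map_graph left_copy (shell_graph m)"
    and "T \<equiv> map_graph right_copy (shell_graph n)"
  shows "pverts (bow_graph m n) = pverts S \<union> pverts T"
    and "parcs (bow_graph m n) = parcs S \<union> parcs T"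
    and "pverts S \<inter> pverts T = {Inl ()}"
proof -
  have L: "left_copy (Inl i) = Inr (Inl i)" "left_copy (Inr u) = Inl u"
    and R: "right_copy (Inl i) = Inr (Inr i)" "right_copy (Inr u) = Inl u" for i u
    by (simp_all add: left_copy_def right_copy_def)
  note defs = S_def T_def bow_graph_def shell_graph_def join_graph_def disjoint_union_graph_def
    single_vertex_graph_def map_graph_def Plus_def
  show "pverts (bow_graph m n) = pverts S \<union> pverts T"
    by (simp add: defs image_Un image_image L R)
  show "parcs (bow_graph m n) = parcs S \<union> parcs T"
    by (simp add: defs image_Un image_image map_prod_def case_prod_beta L R)
       (auto simp: image_iff L R)
  show "pverts S \<inter> pverts T = {Inl ()}"
    by (auto simp: defs L R)
qed

lemma sym_map_prod: "sym A \<Longrightarrow> sym (map_prod f f ` A)"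
  by (fastforce simp: sym_def)

lemma pair_graph_bow_graph: "pair_graph (bow_graph m n)"
proof
  let ?G = "bow_graph m n"
  note defs = bow_graph_def join_graph_def disjoint_union_graph_def single_vertex_graph_def
    path_graph_def
  show "fst e \<in> pverts ?G" "snd e \<in> pverts ?G" if "e \<in> parcs ?G" for e
    using that by (auto simp: defs)
  show finV: "finite (pverts ?G)"
    by (simp add: defs)
  show "finite (parcs ?G)"
    by (rule finite_subset[of _ "pverts ?G \<times> pverts ?G"]) (auto simp: finV, auto simp: defs)
  show "fst e \<noteq> snd e" if "e \<in> parcs ?G" for e
    using that by (auto simp: defs)
  have "sym (parcs (path_graph k))" for k
    by (auto simp: path_graph_def sym_def)
  then have "sym (parcs (disjoint_union_graph (path_graph (m - 1)) (path_graph (n - 1))))"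
    by (auto simp: disjoint_union_graph_def intro!: sym_Un sym_map_prod)
  moreover have "parcs (join_graph single_vertex_graph H) =
      map_prod Inr Inr ` parcs H \<union> ({Inl ()} \<times> Inr ` pverts H \<union> Inr ` pverts H \<times> {Inl ()})"
    for H :: "(nat + nat) pair_pre_digraph"
    by (auto simp: join_graph_def disjoint_union_graph_def single_vertex_graph_def)
  ultimately have "sym (parcs ?G)"
    unfolding bow_graph_def by (auto intro!: sym_Un[OF sym_map_prod] simp: sym_def)
  then show "symmetric (with_proj ?G)"
    by (simp add: symmetric_def)
qed

lemma connected_bow_graph: "connected (with_proj (bow_graph m n))"
proof -
  let ?G = "bow_graph m n"
  interpret pair_graph ?G by (rule pair_graph_bow_graph)
  let ?c = "Inl () :: unit + (nat + nat)"
  have c: "?c \<in> pverts ?G"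
    by (simp add: bow_graph_def join_graph_def single_vertex_graph_def Plus_def)
  have adj: "v = ?c \<or> (?c, v) \<in> parcs ?G \<and> (v, ?c) \<in> parcs ?G" if "v \<in> pverts ?G" for v
    using that
    by (auto simp: bow_graph_def join_graph_def disjoint_union_graph_def single_vertex_graph_def)
  have "?c \<rightarrow>\<^sup>*\<^bsub>with_proj ?G\<^esub> v \<and> v \<rightarrow>\<^sup>*\<^bsub>with_proj ?G\<^esub> ?c" if "v \<in> pverts ?G" for v
    using adj[OF that] c by (auto intro: reachable_adjI)
  then have "u \<rightarrow>\<^sup>*\<^bsub>with_proj ?G\<^esub> v" if "u \<in> pverts ?G" "v \<in> pverts ?G" for u v
    using that reachable_trans by blast
  moreover have "symmetric (with_proj ?G)"
    by (rule sym_arcs)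
  ultimately show ?thesis
    using c by (intro connectedI) (auto simp: reachable_mk_symmetric_eq)
qed

end

theory Submission
  imports Defs
begin

text \<open>
  The apex is adjacent to every other vertex, so the diameter is at most two and non-adjacent
  vertices are \<open>X\<close>-visible iff they have a common neighbour outside \<open>X\<close>. Hence every set avoiding
  the apex is a mutual-visibility set, which gives \<open>(1 + x)\<close> to the power \<open>m + n - 2\<close>. If the apex
  belongs to the set, it blocks all pairs from different paths, and inside one path it leaves only
  the empty set, singletons and pairs at distance one or two; these yield the remaining terms.
\<close>

section \<open>Visibility at distance at most two\<close>

lemma (in pair_graph) vpath_adjacent:
  "(u, v) \<in> parcs G \<Longrightarrow> vpath [u, v] (with_proj G)"
  using no_loops[of "(u, v)"] in_arcsD1[of u v] in_arcsD2[of u v]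
  by (auto simp: vpath_def vwalk_def arcs_ends_def arc_to_ends_def)

lemma (in pair_graph) vpath_common_neighbour:
  assumes "(u, w) \<in> parcs G" "(w, v) \<in> parcs G" "u \<noteq> v"
  shows "vpath [u, w, v] (with_proj G)"
  using assms vpath_adjacent[of u w] vpath_adjacent[of w v]
  by (auto simp: vpath_def vwalk_def)

text \<open>An edge has no interior vertex that \<open>X\<close> could block. For distinct
  non-adjacent vertices, \<open>diam\<close> supplies a path with two arcs and nothing shorter
  exists, so the shortest paths are exactly the lists \<open>[u, w, v]\<close>, one for each common
  neighbour \<open>w\<close>.\<close>

lemma (in pair_graph) visible_diameter_two_iff:
  assumes u: "u \<in> pverts G" and v: "v \<in> pverts G"
    and diam: "u = v \<or> (u, v) \<in> parcs G \<or> (\<exists>w. (u, w) \<in> parcs G \<and> (w, v) \<in> parcs G)"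
  shows "visible G X u v \<longleftrightarrow>
    u = v \<or> (u, v) \<in> parcs G \<or> (\<exists>w. w \<notin> X \<and> (u, w) \<in> parcs G \<and> (w, v) \<in> parcs G)"
proof -
  have len1: "vwalk_length q \<ge> 1" if "vpath q (with_proj G)" "hd q = u" "last q = v" "u \<noteq> v" for q
    using that by (cases q rule: vwalk_arcs.cases) (auto simp: vpath_def vwalk_def)
  have len2: "vwalk_length q \<ge> 2"
    if q: "vpath q (with_proj G)" "hd q = u" "last q = v" "u \<noteq> v" "(u, v) \<notin> parcs G" for q
  proof -
    obtain y ys where "q = u # y # ys"
      using q by (cases q rule: vwalk_arcs.cases) (auto simp: vpath_def vwalk_def)
    with q show ?thesis
      by (cases ys) (auto simp: vpath_def vwalk_def arcs_ends_def arc_to_ends_def)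
  qed
  consider "u = v" | "u \<noteq> v" "(u, v) \<in> parcs G" | "u \<noteq> v" "(u, v) \<notin> parcs G" by blast
  then show ?thesis
  proof cases
    case 1
    then have "shortest_vpath G u v [u]"
      using u by (auto simp: shortest_vpath_def vpath_def vwalk_def)
    with 1 show ?thesis by (auto simp: visible_def)
  next
    case 2
    then have "shortest_vpath G u v [u, v]"
      using len1 vpath_adjacent[of u v] by (auto simp: shortest_vpath_def)
    with 2 show ?thesis by (auto simp: visible_def)
  next
    case 3
    have *: "shortest_vpath G u v p \<longleftrightarrow>
        (\<exists>w. p = [u, w, v] \<and> (u, w) \<in> parcs G \<and> (w, v) \<in> parcs G)" for p
    proof
      assume p: "shortest_vpath G u v p"
      obtain w where "(u, w) \<in> parcs G" "(w, v) \<in> parcs G" using diam 3 by blast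
      then have "vpath [u, w, v] (with_proj G)"
        using 3 vpath_common_neighbour by blast
      with p have "vwalk_length p \<le> vwalk_length [u, w, v]"
        by (auto simp: shortest_vpath_def dest!: spec[of _ "[u, w, v]"])
      moreover have "vwalk_length p \<ge> 2"
        using p 3 len2 by (auto simp: shortest_vpath_def)
      \<comment> \<open>\<open>vwalk_length\<close> counts arcs, so two arcs mean three list
        entries.\<close>
      ultimately have "length p = 3" by auto
      then obtain x y z where "p = [x, y, z]" by (auto simp: length_Suc_conv numeral_3_eq_3)
      with p show "\<exists>w. p = [u, w, v] \<and> (u, w) \<in> parcs G \<and> (w, v) \<in> parcs G"
        by (auto simp: shortest_vpath_def vpath_def vwalk_def arcs_ends_def arc_to_ends_def)
    next
      assume "\<exists>w. p = [u, w, v] \<and> (u, w) \<in> parcs G \<and> (w, v) \<in> parcs G"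
      then obtain w where w: "p = [u, w, v]" "vpath p (with_proj G)"
        using 3 vpath_common_neighbour by blast
      have "vwalk_length p \<le> vwalk_length q"
        if "vpath q (with_proj G)" "hd q = u" "last q = v" for q
        using len2[OF that] 3 w by simp
      with w show "shortest_vpath G u v p"
        by (simp add: shortest_vpath_def)
    qed
    \<comment> \<open>Without loops the middle vertex is not an end, so the condition
      \<open>set p \<inter> X \<subseteq> {u, v}\<close> reduces to
      \<open>w \<notin> X\<close>.\<close>
    have "w \<noteq> u" "w \<noteq> v" if "(u, w) \<in> parcs G" "(w, v) \<in> parcs G" for w
      using that no_loops by force+
    with 3 show ?thesis
      unfolding visible_def * by auto
  qed
qed

text \<open>Grouping the sets by cardinality gives the coefficients back. In this form, splitting
  the family of mutual-visibility sets splits the polynomial directly.\<close>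

lemma visibility_poly_eq_sum:
  assumes "finite (pverts G)"
  shows "visibility_poly G = (\<Sum>X | mutual_visibility_set G X. [:0, 1:] ^ card X)"
proof -
  let ?M = "{X. mutual_visibility_set G X}"
  have sub: "?M \<subseteq> Pow (pverts G)"
    by (auto simp: mutual_visibility_set_def)
  then have fin: "finite ?M"
    using assms finite_subset by auto
  \<comment> \<open>No set is lost by cutting the degrees off at the number of vertices.\<close>
  have "card ` ?M \<subseteq> {..card (pverts G)}"
    using sub assms by (auto intro: card_mono)
  then have "(\<Sum>X\<in>?M. [:0, 1:] ^ card X) =
      (\<Sum>i\<le>card (pverts G). \<Sum>X | X \<in> ?M \<and> card X = i. [:0, 1 :: int:] ^ card X)"
    using fin by (intro sum.group[symmetric]) auto
  also have "\<dots> = visibility_poly G"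
    unfolding visibility_poly_def by (intro sum.cong) (auto simp: monom_altdef of_nat_poly)
  finally show ?thesis by simp
qed

section \<open>Generating sums for traces on a path and for power sets\<close>

text \<open>
  The traces on a path of the mutual-visibility sets that contain an apex joined to the path: two
  path vertices at distance at least two are then visible only through a common neighbour on the path.
\<close>

definition apex_traces :: "nat \<Rightarrow> nat set set" where
  "apex_traces k =
     {Z. Z \<subseteq> {..<k} \<and> (\<forall>i\<in>Z. \<forall>j\<in>Z. i < j \<longrightarrow> j = i + 1 \<or> j = i + 2 \<and> i + 1 \<notin> Z)}"

text \<open>The least element \<open>i\<close> decides: any other element is \<open>i + 1\<close> or
  \<open>i + 2\<close>, and the presence of \<open>i + 1\<close> excludes
  \<open>i + 2\<close>.\<close>

lemma apex_traces_eq: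
  "apex_traces k = insert {} ((\<lambda>i. {i}) ` {..<k} \<union>
     ((\<lambda>i. {i, i + 1}) ` {..<k - 1} \<union> (\<lambda>i. {i, i + 2}) ` {..<k - 2}))"
  (is "_ = ?R")
proof
  show "apex_traces k \<subseteq> ?R"
  proof
    fix Z assume Z: "Z \<in> apex_traces k"
    show "Z \<in> ?R"
    proof (cases "Z = {}")
      case False
      define i where "i = (LEAST x. x \<in> Z)"
      have i: "i \<in> Z" "\<And>x. x \<in> Z \<Longrightarrow> i \<le> x"
        using False unfolding i_def by (auto intro: LeastI Least_le)
      have bd: "x < k" if "x \<in> Z" for x
        using Z that by (auto simp: apex_traces_def)
      have up: "x = i \<or> x = i + 1 \<or> x = i + 2 \<and> i + 1 \<notin> Z" if "x \<in> Z" for x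
        using Z i that le_neq_implies_less unfolding apex_traces_def by blast
      consider "i + 1 \<in> Z" | "i + 1 \<notin> Z" "i + 2 \<in> Z" | "i + 1 \<notin> Z" "i + 2 \<notin> Z" by blast
      then show ?thesis
      proof cases
        case 1
        then have "Z = {i, i + 1}" using i up by blast
        moreover have "i < k - 1" using bd[OF 1] by simp
        ultimately show ?thesis by blast
      next
        case 2
        then have "Z = {i, i + 2}" using i up by blast
        moreover have "i < k - 2" using bd[OF 2(2)] by simp
        ultimately show ?thesis by blast
      next
        case 3
        then have "Z = {i}" using i up by blast
        then show ?thesis using bd[OF i(1)] by blast
      qed
    qed simp
  qed
  show "?R \<subseteq> apex_traces k"
    by (auto simp: apex_traces_def)
qed

lemma finite_apex_traces: "finite (apex_traces k)"
  by (simp add: apex_traces_eq)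

text \<open>There are \<open>k\<close> singletons, \<open>k - 1\<close> pairs at distance one and
  \<open>k - 2\<close> pairs at distance two. The bound on \<open>k\<close> makes these
  natural-number differences agree with those in the ring.\<close>

lemma sum_apex_traces:
  assumes "k \<ge> 2"
  shows "(\<Sum>Z\<in>apex_traces k. x ^ card Z) =
    1 + of_nat k * x + (2 * of_nat k - 3) * (x :: 'a :: comm_ring_1) ^ 2"
proof -
  let ?P1 = "(\<lambda>i. {i}) ` {..<k}" and ?P2 = "(\<lambda>i. {i, i + 1}) ` {..<k - 1}"
    and ?P3 = "(\<lambda>i. {i, i + 2}) ` {..<k - 2}"
  have pairs: "(\<Sum>Z\<in>(\<lambda>i. {i, i + d}) ` A. x ^ card Z) = of_nat (card A) * x ^ 2"
    if "d > 0" for d :: nat and A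
  proof -
    \<comment> \<open>The pair determines \<open>i\<close> as its minimum.\<close>
    have "inj_on (\<lambda>i. {i, i + d}) A"
      by (auto simp: inj_on_def doubleton_eq_iff)
    then show ?thesis
      using that by (simp add: sum.reindex card_insert_if power2_eq_square)
  qed
  have 1: "(\<Sum>Z\<in>?P1. x ^ card Z) = of_nat k * x"
    by (simp add: sum.reindex)
  have 2: "(\<Sum>Z\<in>?P2. x ^ card Z) = (of_nat k - 1) * x ^ 2"
    using assms by (subst pairs) (auto simp: of_nat_diff)
  have 3: "(\<Sum>Z\<in>?P3. x ^ card Z) = (of_nat k - 2) * x ^ 2"
    using assms by (subst pairs) (auto simp: of_nat_diff)
  have "?P2 \<inter> ?P3 = {}" "?P1 \<inter> (?P2 \<union> ?P3) = {}" "{} \<notin> ?P1 \<union> (?P2 \<union> ?P3)"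
    by (auto simp: doubleton_eq_iff)
  then have "(\<Sum>Z\<in>apex_traces k. x ^ card Z) =
      1 + (of_nat k * x + ((of_nat k - 1) * x ^ 2 + (of_nat k - 2) * x ^ 2))"
    unfolding apex_traces_eq 1[symmetric] 2[symmetric] 3[symmetric]
    by (subst sum.insert; simp add: sum.union_disjoint)
  then show ?thesis by (simp add: algebra_simps)
qed

text \<open>Expand the product over \<open>A\<close> of the factors \<open>x + 1\<close>: a subset
  records where \<open>x\<close> is chosen.\<close>

lemma sum_Pow_power_card:
  assumes "finite A"
  shows "(\<Sum>X\<in>Pow A. x ^ card X) = (1 + x :: 'a :: comm_semiring_1) ^ card A"
  using prod_add[OF assms, of "\<lambda>_. x" "\<lambda>_. 1"] by (simp add: add.commute)

section \<open>Mutual-visibility sets of the bow graph\<close>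

abbreviation "apex \<equiv> Inl () :: unit + (nat + nat)"
abbreviation "lft \<equiv> (\<lambda>i. Inr (Inl i)) :: nat \<Rightarrow> unit + (nat + nat)"
abbreviation "rgt \<equiv> (\<lambda>i. Inr (Inr i)) :: nat \<Rightarrow> unit + (nat + nat)"

lemma pverts_bow_graph:
  "pverts (bow_graph m n) = insert apex (lft ` {..<m - 1} \<union> rgt ` {..<n - 1})"
  by (auto simp: bow_graph_def join_graph_def disjoint_union_graph_def single_vertex_graph_def
      path_graph_def)

lemma arcs_bow_graph:
  "(apex, apex) \<notin> parcs (bow_graph m n)"
  "(apex, lft i) \<in> parcs (bow_graph m n) \<longleftrightarrow> i < m - 1"
  "(lft i, apex) \<in> parcs (bow_graph m n) \<longleftrightarrow> i < m - 1"
  "(apex, rgt j) \<in> parcs (bow_graph m n) \<longleftrightarrow> j < n - 1"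
  "(rgt j, apex) \<in> parcs (bow_graph m n) \<longleftrightarrow> j < n - 1"
  "(lft i, lft i') \<in> parcs (bow_graph m n) \<longleftrightarrow>
     i < m - 1 \<and> i' < m - 1 \<and> (i' = Suc i \<or> i = Suc i')"
  "(rgt j, rgt j') \<in> parcs (bow_graph m n) \<longleftrightarrow>
     j < n - 1 \<and> j' < n - 1 \<and> (j' = Suc j \<or> j = Suc j')"
  "(lft i, rgt j) \<notin> parcs (bow_graph m n)"
  "(rgt j, lft i) \<notin> parcs (bow_graph m n)"
  by (force simp: bow_graph_def join_graph_def disjoint_union_graph_def single_vertex_graph_def
      path_graph_def)+

lemma visible_bow_graph_iff:
  assumes "u \<in> pverts (bow_graph m n)" "v \<in> pverts (bow_graph m n)"
  shows "visible (bow_graph m n) X u v \<longleftrightarrow>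
    u = v \<or> (u, v) \<in> parcs (bow_graph m n) \<or>
    (\<exists>w. w \<notin> X \<and> (u, w) \<in> parcs (bow_graph m n) \<and> (w, v) \<in> parcs (bow_graph m n))"
proof -
  interpret pair_graph "bow_graph m n" by (rule pair_graph_bow_graph)
  have "z = apex \<or> (z, apex) \<in> parcs (bow_graph m n) \<and> (apex, z) \<in> parcs (bow_graph m n)"
    if "z \<in> pverts (bow_graph m n)" for z
    using that by (auto simp: pverts_bow_graph arcs_bow_graph)
  then show ?thesis
    using assms by (intro visible_diameter_two_iff) blast+
qed

lemma mutual_visibility_bow_without_apex:
  assumes "apex \<notin> X"
  shows "mutual_visibility_set (bow_graph m n) X \<longleftrightarrow> X \<subseteq> lft ` {..<m - 1} \<union> rgt ` {..<n - 1}"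
proof
  assume X: "X \<subseteq> lft ` {..<m - 1} \<union> rgt ` {..<n - 1}"
  have "visible (bow_graph m n) X u v" if "u \<in> X" "v \<in> X" for u v
  proof -
    have "(u, apex) \<in> parcs (bow_graph m n)" "(apex, v) \<in> parcs (bow_graph m n)"
      using X that by (auto simp: arcs_bow_graph)
    moreover have "u \<in> pverts (bow_graph m n)" "v \<in> pverts (bow_graph m n)"
      using X that by (auto simp: pverts_bow_graph)
    ultimately show ?thesis using assms visible_bow_graph_iff by blast
  qed
  then show "mutual_visibility_set (bow_graph m n) X"
    using X by (auto simp: mutual_visibility_set_def pverts_bow_graph)
qed (use assms in \<open>auto simp: mutual_visibility_set_def pverts_bow_graph\<close>)

text \<open>With the apex in \<open>X\<close>, a common neighbour outside \<open>X\<close> of two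
  distinct path vertices must lie on a path: there is none for different paths, and only the middle
  vertex at distance two on the same path. Both orders are listed because
  \<open>mutual_visibility_set\<close> ranges over ordered pairs.\<close>

lemma visible_bow_with_apex:
  assumes "apex \<in> X"
  shows "i < m - 1 \<Longrightarrow> visible (bow_graph m n) X apex (lft i)"
    and "i < m - 1 \<Longrightarrow> visible (bow_graph m n) X (lft i) apex"
    and "j < n - 1 \<Longrightarrow> visible (bow_graph m n) X apex (rgt j)"
    and "j < n - 1 \<Longrightarrow> visible (bow_graph m n) X (rgt j) apex"
    and "visible (bow_graph m n) X apex apex"
    and "i < m - 1 \<Longrightarrow> j < n - 1 \<Longrightarrow> \<not> visible (bow_graph m n) X (lft i) (rgt j)"
    and "i < m - 1 \<Longrightarrow> j < n - 1 \<Longrightarrow> \<not> visible (bow_graph m n) X (rgt j) (lft i)"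
    and "i < m - 1 \<Longrightarrow> i' < m - 1 \<Longrightarrow> visible (bow_graph m n) X (lft i) (lft i') \<longleftrightarrow>
      i = i' \<or> i' = i + 1 \<or> i = i' + 1 \<or> i' = i + 2 \<and> lft (i + 1) \<notin> X \<or>
      i = i' + 2 \<and> lft (i' + 1) \<notin> X"
    and "j < n - 1 \<Longrightarrow> j' < n - 1 \<Longrightarrow> visible (bow_graph m n) X (rgt j) (rgt j') \<longleftrightarrow>
      j = j' \<or> j' = j + 1 \<or> j = j' + 1 \<or> j' = j + 2 \<and> rgt (j + 1) \<notin> X \<or>
      j = j' + 2 \<and> rgt (j' + 1) \<notin> X"
  using assms
  by (subst visible_bow_graph_iff;
      auto simp: pverts_bow_graph arcs_bow_graph split_sum_ex less_Suc_eq)+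

text \<open>Pairs from different paths are never visible, which forces \<open>A\<close> or
  \<open>B\<close> to be empty; pairs within one path give the trace conditions.\<close>

lemma mutual_visibility_bow_with_apex:
  assumes "A \<subseteq> {..<m - 1}" "B \<subseteq> {..<n - 1}"
  shows "mutual_visibility_set (bow_graph m n) (insert apex (lft ` A \<union> rgt ` B)) \<longleftrightarrow>
    (A = {} \<or> B = {}) \<and> A \<in> apex_traces (m - 1) \<and> B \<in> apex_traces (n - 1)"
proof -
  let ?X = "insert apex (lft ` A \<union> rgt ` B)"
  \<comment> \<open>The definition constrains only \<open>i < j\<close>; this symmetric form matches
    the visibility criterion for ordered pairs.\<close>
  have trace: "Z \<in> apex_traces k \<longleftrightarrow>
      (\<forall>i\<in>Z. \<forall>j\<in>Z. i = j \<or> j = i + 1 \<or> i = j + 1 \<or> j = i + 2 \<and> i + 1 \<notin> Z \<or> i = j + 2 \<and> j + 1 \<notin> Z)"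
    (is "_ = ?S") if "Z \<subseteq> {..<k}" for Z k
  proof
    show ?S if "Z \<in> apex_traces k"
      using that unfolding apex_traces_def mem_Collect_eq by (metis linorder_neqE_nat)
    show "Z \<in> apex_traces k" if ?S
      using that \<open>Z \<subseteq> {..<k}\<close> unfolding apex_traces_def by fastforce
  qed
  have lt: "i \<in> A \<Longrightarrow> i < m - 1" "j \<in> B \<Longrightarrow> j < n - 1" for i j
    using assms by auto
  note vis = visible_bow_with_apex[of ?X]
  have "mutual_visibility_set (bow_graph m n) ?X \<longleftrightarrow>
      (\<forall>u\<in>?X. \<forall>v\<in>?X. visible (bow_graph m n) ?X u v)"
    using assms by (auto simp: mutual_visibility_set_def pverts_bow_graph)
  also have "\<dots> \<longleftrightarrow> (A = {} \<or> B = {}) \<and>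
     (\<forall>i\<in>A. \<forall>j\<in>A. visible (bow_graph m n) ?X (lft i) (lft j)) \<and>
     (\<forall>i\<in>B. \<forall>j\<in>B. visible (bow_graph m n) ?X (rgt i) (rgt j))"
    using lt vis(1-7) by (auto simp: ball_Un)
  also have "\<dots> \<longleftrightarrow> (A = {} \<or> B = {}) \<and> A \<in> apex_traces (m - 1) \<and> B \<in> apex_traces (n - 1)"
    using assms lt by (auto simp: trace vis image_iff)
  finally show ?thesis .
qed

lemma mutual_visibility_sets_bow_graph:
  "{X. mutual_visibility_set (bow_graph m n) X} =
     Pow (lft ` {..<m - 1} \<union> rgt ` {..<n - 1}) \<union>
     ((\<lambda>A. insert apex (lft ` A)) ` apex_traces (m - 1) \<union>
      (\<lambda>B. insert apex (rgt ` B)) ` apex_traces (n - 1))"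
  (is "?M = ?P \<union> (?L \<union> ?R)")
proof (intro set_eqI)
  fix X
  have empty: "{} \<in> apex_traces k" for k
    by (simp add: apex_traces_def)
  show "X \<in> ?M \<longleftrightarrow> X \<in> ?P \<union> (?L \<union> ?R)"
  proof (cases "apex \<in> X")
    case False
    then show ?thesis
      by (auto simp: mutual_visibility_bow_without_apex)
  next
    case True
    show ?thesis
    proof
      assume M: "X \<in> ?M"
      define A B where "A = {i. lft i \<in> X}" and "B = {j. rgt j \<in> X}"
      have sub: "X \<subseteq> pverts (bow_graph m n)"
        using M by (simp add: mutual_visibility_set_def)
      then have AB: "A \<subseteq> {..<m - 1}" "B \<subseteq> {..<n - 1}"
        by (auto simp: A_def B_def pverts_bow_graph)
      have X: "X = insert apex (lft ` A \<union> rgt ` B)"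
        using True sub by (auto simp: A_def B_def pverts_bow_graph)
      from M show "X \<in> ?P \<union> (?L \<union> ?R)"
        unfolding X mem_Collect_eq mutual_visibility_bow_with_apex[OF AB] by auto
    next
      assume "X \<in> ?P \<union> (?L \<union> ?R)"
      then consider A where "A \<in> apex_traces (m - 1)" "X = insert apex (lft ` A)"
        | B where "B \<in> apex_traces (n - 1)" "X = insert apex (rgt ` B)"
        using True by blast
      then show "X \<in> ?M"
      proof cases
        case 1
        then show ?thesis
          using mutual_visibility_bow_with_apex[of A m "{}" n] empty by (simp add: apex_traces_def)
      next
        case 2
        then show ?thesis
          using mutual_visibility_bow_with_apex[of "{}" m B n] empty by (simp add: apex_traces_def)
      qed
    qed
  qed
qed

section \<open>Evaluation of the polynomial\<close>

text \<open>Adding the new element \<open>c\<close> raises each cardinality by one and identifies no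
  two traces, hence the extra factor \<open>x\<close>.\<close>

lemma sum_insert_image_apex_traces:
  fixes x :: "'a :: comm_ring_1"
  assumes "inj f" "c \<notin> range f" "k \<ge> 2"
  shows "(\<Sum>X\<in>(\<lambda>Z. insert c (f ` Z)) ` apex_traces k. x ^ card X) =
    x * (1 + of_nat k * x + (2 * of_nat k - 3) * x ^ 2)"
proof -
  have inj: "inj_on (\<lambda>Z. insert c (f ` Z)) (apex_traces k)"
  proof (rule inj_onI)
    fix Y Z assume "insert c (f ` Y) = insert c (f ` Z)"
    moreover have "c \<notin> f ` Y" "c \<notin> f ` Z" using assms(2) by auto
    ultimately have "f ` Y = f ` Z" by (simp add: insert_ident)
    then show "Y = Z" using assms(1) by (simp add: inj_image_eq_iff)
  qed
  have "card (insert c (f ` Z)) = Suc (card Z)" if "Z \<in> apex_traces k" for Z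
  proof -
    have "finite Z"
      using that finite_subset by (auto simp: apex_traces_def)
    then show ?thesis
      using assms(1,2) by (subst card_insert_disjoint) (auto simp: card_image inj_on_subset)
  qed
  then show ?thesis
    using sum_apex_traces[OF assms(3), of x]
    by (simp add: sum.reindex[OF inj] flip: sum_distrib_left)
qed

theorem theorem15:
  fixes m n :: nat
  assumes "m \<ge> 3" and "n \<ge> 3"
  shows "visibility_poly (bow_graph m n) =
           (1 + [:0, 1:]) ^ (m + n - 2) + [:0, 1:] + of_nat (m + n - 2) * [:0, 1:] ^ 2
             + (2 * of_nat m + 2 * of_nat n - 10) * [:0, 1:] ^ 3"
proof -
  let ?x = "[:0, 1 :: int:]"
  define W where "W = lft ` {..<m - 1} \<union> rgt ` {..<n - 1}"
  define L where "L = (\<lambda>A. insert apex (lft ` A)) ` apex_traces (m - 1)"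
  define R where "R = (\<lambda>B. insert apex (rgt ` B)) ` apex_traces (n - 1)"
  have fin: "finite W" "finite L" "finite R"
    by (auto simp: W_def L_def R_def finite_apex_traces)
  have "card W = (m - 1) + (n - 1)"
    unfolding W_def by (subst card_Un_disjoint) (auto simp: card_image inj_on_def)
  then have W: "card W = m + n - 2"
    using assms by simp
  \<comment> \<open>The images of \<open>lft\<close> and \<open>rgt\<close> are disjoint, so a
    common member has an empty trace on both paths.\<close>
  have "X = {apex}" if "X \<in> L" "X \<in> R" for X
    using that unfolding L_def R_def by blast
  moreover have "{apex} \<in> L" "{apex} \<in> R"
    by (force simp: L_def R_def apex_traces_def)+
  ultimately have LR: "L \<inter> R = {{apex}}"
    by blast
  have "visibility_poly (bow_graph m n) = (\<Sum>X\<in>Pow W \<union> (L \<union> R). ?x ^ card X)"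
    by (simp add: visibility_poly_eq_sum pverts_bow_graph mutual_visibility_sets_bow_graph
        W_def L_def R_def)
  \<comment> \<open>Disjointness: members of \<open>Pow W\<close> avoid the apex, those of
    \<open>L\<close> and \<open>R\<close> contain it.\<close>
  also have "\<dots> = (\<Sum>X\<in>Pow W. ?x ^ card X) + (\<Sum>X\<in>L \<union> R. ?x ^ card X)"
    using fin by (intro sum.union_disjoint) (auto simp: W_def L_def R_def)
  \<comment> \<open>Inclusion-exclusion: the singleton of the apex is counted in both families and
    contributes \<open>?x\<close>.\<close>
  also have "(\<Sum>X\<in>L \<union> R. ?x ^ card X) =
      (\<Sum>X\<in>L. ?x ^ card X) + (\<Sum>X\<in>R. ?x ^ card X) - ?x"
    using fin by (simp add: sum_Un LR)
  also have "(\<Sum>X\<in>L. ?x ^ card X) =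
      ?x * (1 + of_nat (m - 1) * ?x + (2 * of_nat (m - 1) - 3) * ?x ^ 2)"
    unfolding L_def using assms by (intro sum_insert_image_apex_traces) (auto simp: inj_def)
  also have "(\<Sum>X\<in>R. ?x ^ card X) =
      ?x * (1 + of_nat (n - 1) * ?x + (2 * of_nat (n - 1) - 3) * ?x ^ 2)"
    unfolding R_def using assms by (intro sum_insert_image_apex_traces) (auto simp: inj_def)
  also have "(\<Sum>X\<in>Pow W. ?x ^ card X) = (1 + ?x) ^ (m + n - 2)"
    using sum_Pow_power_card[OF fin(1)] W by simp
  finally have *: "visibility_poly (bow_graph m n) = (1 + ?x) ^ (m + n - 2) +
      (?x * (1 + of_nat (m - 1) * ?x + (2 * of_nat (m - 1) - 3) * ?x ^ 2) +
       ?x * (1 + of_nat (n - 1) * ?x + (2 * of_nat (n - 1) - 3) * ?x ^ 2) - ?x)" .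
  have "x * (1 + of_nat (m - 1) * x + (2 * of_nat (m - 1) - 3) * x ^ 2) +
      x * (1 + of_nat (n - 1) * x + (2 * of_nat (n - 1) - 3) * x ^ 2) - x =
      x + of_nat (m + n - 2) * x ^ 2 + (2 * of_nat m + 2 * of_nat n - 10) * x ^ 3"
    for x :: "int poly"
  proof -
    \<comment> \<open>Truncated subtraction must become ring subtraction before
      \<open>algebra\<close> applies. The cubic coefficient is then
      \<open>2 * (m - 1) - 3 + 2 * (n - 1) - 3\<close>.\<close>
    have "of_nat (m - 1) = (of_nat m - 1 :: int poly)" "of_nat (n - 1) = (of_nat n - 1 :: int poly)"
      "of_nat (m + n - 2) = (of_nat m + of_nat n - 2 :: int poly)"
      using assms by (simp_all add: of_nat_diff)
    then show ?thesis by algebra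
  qed
  from this[of ?x] show ?thesis
    unfolding * by (simp only: add.assoc)
qed

end
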